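(* Let $H$ be an infinite-dimensional separable complex Hilbert space and let $\mathbb{X}$ be a topological space with at most countably many connected components. Let $\mathcal{S},\mathcal{T}\in\mathcal{C}(\mathbb{X},Fred(H))$ be Fredholm homotopic. Then $ind(\mathcal{T})=ind(\mathcal{S})$.
   Context: $L(H)$ is the algebra of bounded linear operators on $H$. An operator $T\in L(H)$ is Fredholm if $\dim N(T)$ and $\mathrm{codim}\,R(T)$ are both finite; its index is $ind(T)=\dim N(T)-\mathrm{codim}\,R(T)$. $Fred(H)$ is the set of Fredholm operators with the norm topology, and $\mathcal{C}(\mathbb{X},Fred(H))$ is the set of continuous maps $\mathcal{T}:\mathbb{X}\to Fred(H)$, $x\mapsto\mathcal{T}_x$. The index of such a family is $ind(\mathcal{T})=(ind(\mathcal{T}_x))_{\overline{x}\in\mathbb{X}^c}\in\mathbb{Z}^{n_c}$, where $\mathbb{X}^c$ is the set of connected components of $\mathbb{X}$, $\overline{x}$ is the connected component of $x$, and $n_c$ is the cardinality of $\mathbb{X}^c$ (the value $ind(\mathcal{T}_x)$ depends only on $\overline{x}$). Two families $\mathcal{S},\mathcal{T}\in\mathcal{C}(\mathbb{X},Fred(H))$ are Fredholm homotopic if there is a continuous map $\Phi:[0,1]\times\mathbb{X}\to L(H)$ such that for all $(t,x)\in[0,1]\times\mathbb{X}$: $\Phi(0,x)=\mathcal{S}_x$, $\Phi(1,x)=\mathcal{T}_x$, and $\Phi(t,x)$ is a Fredholm operator. *)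

theory Defs
  imports "HOL-Analysis.Analysis"
begin

(* The real structure required by the superclass banach is the restriction of the
   complex one (scaleR_scaleC), and the norm is the one induced by the inner product. *)
class complex_hilbert = banach +
  fixes scaleC :: "complex \<Rightarrow> 'a \<Rightarrow> 'a" (infixr "*\<^sub>C" 75)
    and cinner :: "'a \<Rightarrow> 'a \<Rightarrow> complex"
  assumes scaleC_add_right: "a *\<^sub>C (x + y) = a *\<^sub>C x + a *\<^sub>C y"
    and scaleC_add_left: "(a + b) *\<^sub>C x = a *\<^sub>C x + b *\<^sub>C x"
    and scaleC_scaleC: "a *\<^sub>C b *\<^sub>C x = (a * b) *\<^sub>C x"
    and scaleC_one: "1 *\<^sub>C x = x"
    and scaleR_scaleC: "r *\<^sub>R x = complex_of_real r *\<^sub>C x"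
    and cinner_commute: "cinner x y = cnj (cinner y x)"
    and cinner_add_left: "cinner (x + y) z = cinner x z + cinner y z"
    and cinner_scaleC_left: "cinner (a *\<^sub>C x) y = a * cinner x y"
    and cinner_ge_zero: "0 \<le> Re (cinner x x)"
    and cinner_eq_zero_iff: "cinner x x = 0 \<longleftrightarrow> x = 0"
    and norm_eq_sqrt_cinner: "norm x = sqrt (Re (cinner x x))"

interpretation complex_vector:
  vector_space "scaleC :: complex \<Rightarrow> 'a \<Rightarrow> 'a::complex_hilbert"
  by unfold_locales (fact scaleC_add_right scaleC_add_left scaleC_scaleC scaleC_one)+

definition cfinite_dim :: "'a::complex_hilbert set \<Rightarrow> bool" where
  "cfinite_dim V \<longleftrightarrow> (\<exists>B. finite B \<and> V \<subseteq> complex_vector.span B)"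

definition ccomplement :: "'a::complex_hilbert set \<Rightarrow> 'a set \<Rightarrow> bool" where
  "ccomplement M W \<longleftrightarrow> complex_vector.subspace W \<and> M \<inter> W = {0} \<and>
     (\<forall>x. \<exists>m\<in>M. \<exists>w\<in>W. x = m + w)"

(* codim M = dim (H / M), with the quotient represented by an algebraic complement of M
   (no topological condition); see ccodim_eq for independence of the choice. *)
definition cfinite_codim :: "'a::complex_hilbert set \<Rightarrow> bool" where
  "cfinite_codim M \<longleftrightarrow> (\<exists>W. ccomplement M W \<and> cfinite_dim W)"

definition ccodim :: "'a::complex_hilbert set \<Rightarrow> nat" where
  "ccodim M = complex_vector.dim (SOME W. ccomplement M W)"

lemma ccomplement_dim_le:
  fixes M W V :: "'a::complex_hilbert set"
  assumes M: "complex_vector.subspace M"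
    and W: "ccomplement M W" and V: "ccomplement M V" "cfinite_dim V"
  shows "cfinite_dim W \<and> complex_vector.dim W \<le> complex_vector.dim V"
proof -
  have sW: "complex_vector.subspace W" and sV: "complex_vector.subspace V"
    and MW: "M \<inter> W = {0}" and MV: "M \<inter> V = {0}"
    using W V by (auto simp: ccomplement_def)
  have "\<forall>x. \<exists>v. v \<in> V \<and> x - v \<in> M"
    using V(1) unfolding ccomplement_def by (metis add_diff_cancel_right')
  then obtain p where p: "\<And>x. p x \<in> V" "\<And>x. x - p x \<in> M" by metis
  have uniq: "v = p x" if "v \<in> V" "x - v \<in> M" for v x
  proof -
    have "v - p x \<in> V" using that p sV complex_vector.subspace_diff by blast
    moreover have "(x - p x) - (x - v) \<in> M"
      using that p M complex_vector.subspace_diff by blast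
    then have "v - p x \<in> M" by simp
    ultimately have "v - p x \<in> M \<inter> V" by blast
    then show ?thesis using MV by simp
  qed
  have add: "p (x + y) = p x + p y" for x y
  proof -
    have "p x + p y \<in> V" using p sV complex_vector.subspace_add by blast
    moreover have "(x - p x) + (y - p y) \<in> M"
      using p M complex_vector.subspace_add by blast
    then have "(x + y) - (p x + p y) \<in> M" by (simp add: algebra_simps)
    ultimately show ?thesis using uniq by metis
  qed
  have scale: "p (c *\<^sub>C x) = c *\<^sub>C p x" for c x
  proof -
    have "c *\<^sub>C p x \<in> V" using p sV complex_vector.subspace_scale by blast
    moreover have "c *\<^sub>C (x - p x) \<in> M"
      using p M complex_vector.subspace_scale by blast
    then have "c *\<^sub>C x - c *\<^sub>C p x \<in> M"
      by (simp add: complex_vector.scale_right_diff_distrib)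
    ultimately show ?thesis using uniq by metis
  qed
  interpret P: Vector_Spaces.linear
    "scaleC :: complex \<Rightarrow> 'a \<Rightarrow> 'a" "scaleC :: complex \<Rightarrow> 'a \<Rightarrow> 'a" p
    by unfold_locales (use add scale in auto)
  have inj: "inj_on p W"
  proof (rule inj_onI)
    fix x y assume xy: "x \<in> W" "y \<in> W" "p x = p y"
    have "(x - p x) - (y - p y) \<in> M" using p M complex_vector.subspace_diff by blast
    then have "x - y \<in> M" using xy by simp
    moreover have "x - y \<in> W" using xy sW complex_vector.subspace_diff by blast
    ultimately have "x - y \<in> M \<inter> W" by blast
    then show "x = y" using MW by simp
  qed
  obtain B where B: "B \<subseteq> W" "complex_vector.independent B"
      "W \<subseteq> complex_vector.span B" "card B = complex_vector.dim W"
    using complex_vector.basis_exists by blast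
  obtain C where C: "C \<subseteq> V" "complex_vector.independent C"
      "V \<subseteq> complex_vector.span C" "card C = complex_vector.dim V"
    using complex_vector.basis_exists by blast
  have finC: "finite C"
  proof -
    obtain D where "finite D" "V \<subseteq> complex_vector.span D"
      using V(2) by (auto simp: cfinite_dim_def)
    then show ?thesis
      using C complex_vector.independent_span_bound[of D C] by blast
  qed
  have "complex_vector.span B \<subseteq> W"
    using B(1) sW by (rule complex_vector.span_minimal)
  then have "inj_on p (complex_vector.span B)" using inj by (rule inj_on_subset[rotated])
  then have "complex_vector.independent (p ` B)"
    using B(2) P.independent_injective_image by blast
  moreover have "p ` B \<subseteq> complex_vector.span C" using p(1) C(3) by blast
  ultimately have *: "finite (p ` B) \<and> card (p ` B) \<le> card C"
    using complex_vector.independent_span_bound[OF finC] by blast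
  have "inj_on p B" using inj B(1) by (rule inj_on_subset)
  with * have "finite B" "card B \<le> card C"
    by (auto dest: finite_imageD simp: card_image)
  then show ?thesis using B C by (auto simp: cfinite_dim_def)
qed

lemma ccodim_eq:
  assumes "complex_vector.subspace M" "ccomplement M W" "cfinite_dim W"
  shows "ccodim M = complex_vector.dim W"
proof -
  have S: "ccomplement M (SOME W. ccomplement M W)"
    using assms(2) by (rule someI)
  have "cfinite_dim (SOME W. ccomplement M W)"
    using ccomplement_dim_le[OF assms(1) S assms(2,3)] by blast
  then show ?thesis
    unfolding ccodim_def
    using ccomplement_dim_le[OF assms(1) S assms(2,3)] ccomplement_dim_le[OF assms(1,2) S]
    by linarith
qed

(* L(H): for a complex linear map, boundedness over the reals and over the complex numbers
   agree, with the same operator norm, so L(H) is a subspace of the normed space of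
   bounded real-linear maps and carries the norm topology from there. *)
definition bounded_ops :: "('a::complex_hilbert \<Rightarrow>\<^sub>L 'a) set" where
  "bounded_ops = {T. \<forall>c x. blinfun_apply T (c *\<^sub>C x) = c *\<^sub>C blinfun_apply T x}"

definition null_space :: "('a::complex_hilbert \<Rightarrow>\<^sub>L 'a) \<Rightarrow> 'a set" where
  "null_space T = {x. blinfun_apply T x = 0}"

definition Fred :: "('a::complex_hilbert \<Rightarrow>\<^sub>L 'a) set" where
  "Fred = {T \<in> bounded_ops. cfinite_dim (null_space T) \<and> cfinite_codim (range (blinfun_apply T))}"

definition fredholm_index :: "('a::complex_hilbert \<Rightarrow>\<^sub>L 'a) \<Rightarrow> int" where
  "fredholm_index T =
     int (complex_vector.dim (null_space T)) - int (ccodim (range (blinfun_apply T)))"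

(* The index of a family as a function on the set of connected components of X; since the
   index is constant on each component, it is evaluated at an arbitrary point of it. *)
definition family_index ::
    "'x topology \<Rightarrow> ('x \<Rightarrow> ('a::complex_hilbert \<Rightarrow>\<^sub>L 'a)) \<Rightarrow> ('x set \<Rightarrow> int)" where
  "family_index X T =
     (\<lambda>C\<in>connected_components_of X. fredholm_index (T (SOME x. x \<in> C)))"

definition fredholm_homotopic ::
    "'x topology \<Rightarrow> ('x \<Rightarrow> ('a::complex_hilbert \<Rightarrow>\<^sub>L 'a)) \<Rightarrow> ('x \<Rightarrow> ('a \<Rightarrow>\<^sub>L 'a)) \<Rightarrow> bool" where
  "fredholm_homotopic X S T \<longleftrightarrow>
     (\<exists>\<Phi>. continuous_map (prod_topology (top_of_set {0..1::real}) X) (top_of_set bounded_ops) \<Phi> \<and>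
        (\<forall>t\<in>{0..1}. \<forall>x\<in>topspace X. \<Phi> (0, x) = S x \<and> \<Phi> (1, x) = T x \<and> \<Phi> (t, x) \<in> Fred))"

end

theory Submission
  imports Defs
begin

text \<open>
  For fixed \<open>x\<close>, a homotopy gives a path \<open>t \<mapsto> \<Phi>(t, x)\<close> of Fredholm operators, so it suffices that the
  index is locally constant. Let \<open>T\<close> be Fredholm with kernel \<open>N\<close>, closed complement \<open>M\<close> of \<open>N\<close>, and
  finite-dimensional complement \<open>W\<close> of the range. The map \<open>M \<times> W \<rightarrow> H\<close>, \<open>(m, w) \<mapsto> T m + w\<close>, is
  bijective with bounded inverse by the open mapping theorem, and by the contraction principle
  \<open>(m, w) \<mapsto> S m + w\<close> is bijective as well for every \<open>S\<close> near \<open>T\<close>. For such \<open>S\<close>, linear algebra gives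
  \<open>ind S = dim N - dim W\<close>, a number that does not depend on \<open>S\<close>.
\<close>

section \<open>Independent sets in complementary spans\<close>

text \<open>In a vanishing combination the \<open>B\<close>-part is the negative of the rest, so
  both lie in the two spans at once and vanish separately.\<close>

lemma (in vector_space) independent_Un_disjoint_spans:
  assumes B: "independent B" and C: "independent C" and BC: "span B \<inter> span C = {0}"
  shows "independent (B \<union> C)"
  unfolding independent_explicit_module
proof (intro allI impI)
  fix t u v
  assume t: "finite t" "t \<subseteq> B \<union> C" and sum0: "(\<Sum>v\<in>t. scale (u v) v) = 0" and v: "v \<in> t"
  have split: "(\<Sum>v\<in>t. scale (u v) v) = (\<Sum>v\<in>t \<inter> B. scale (u v) v) + (\<Sum>v\<in>t - B. scale (u v) v)"
    by (rule sum.Int_Diff[OF t(1)])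
  have "(\<Sum>v\<in>t \<inter> B. scale (u v) v) \<in> span B"
    by (intro span_sum span_scale span_base) auto
  moreover have C': "(\<Sum>v\<in>t - B. scale (u v) v) \<in> span C"
    using t by (intro span_sum span_scale span_base) auto
  moreover have "(\<Sum>v\<in>t \<inter> B. scale (u v) v) = - (\<Sum>v\<in>t - B. scale (u v) v)"
    using split sum0 by (simp add: eq_neg_iff_add_eq_0)
  ultimately have "(\<Sum>v\<in>t \<inter> B. scale (u v) v) \<in> span B \<inter> span C"
    using span_neg[OF C'] by simp
  then have 1: "(\<Sum>v\<in>t \<inter> B. scale (u v) v) = 0" using BC by simp
  then have 2: "(\<Sum>v\<in>t - B. scale (u v) v) = 0" using split sum0 by simp
  show "u v = 0"
  proof (cases "v \<in> B")
    case True
    then show ?thesis using independentD[OF B _ _ 1] t v by auto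
  next
    case False
    then show ?thesis using independentD[OF C _ _ 2] t v by auto
  qed
qed

section \<open>Open mapping theorem with a norm bound\<close>

text \<open>The open mapping theorem in quantitative form: the preimage bound, linear in
  \<open>norm y\<close>, later decides how far a Fredholm operator may be perturbed.\<close>

lemma open_mapping_bound:
  fixes f :: "'a::banach \<Rightarrow> 'b::banach"
  assumes f: "bounded_linear f" and surj: "surj f"
  obtains C where "C > 0" "\<And>y. \<exists>x. f x = y \<and> norm x \<le> C * norm y"
proof -
  interpret f: bounded_linear f by fact
  \<comment> \<open>Baire: the closed sets \<open>F n\<close> cover the target, so one of them contains a ball.\<close>
  define F where "F n = closure (f ` cball 0 (real n))" for n :: nat
  have "\<Union>(range F) = UNIV"
  proof -
    have "y \<in> \<Union>(range F)" for y
    proof -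
      obtain x where x: "y = f x" using surj by blast
      obtain n where "norm x \<le> real n" using real_arch_simple by blast
      then have "y \<in> f ` cball 0 (real n)" using x by auto
      then have "y \<in> F n" unfolding F_def by (rule subsetD[OF closure_subset])
      then show ?thesis by blast
    qed
    then show ?thesis by blast
  qed
  moreover have "Met_TC.mtopology interior_of \<Union>(range F) = {}" if "\<And>n. interior (F n) = {}"
    by (rule Met_TC.metric_Baire_category_alt) (use that in \<open>auto simp: F_def complete_UNIV\<close>)
  ultimately have "\<exists>n. interior (F n) \<noteq> {}" by auto
  then obtain n y0 e where e: "e > 0" "ball y0 e \<subseteq> F n"
    by (meson all_not_in_conv mem_interior)
  \<comment> \<open>Both \<open>y0\<close> and \<open>y0 + y\<close> lie in the ball, so the
    difference of their approximate preimages is one of \<open>y\<close>; this doubles the radius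
    \<open>n\<close> and adds two errors below \<open>d / 2\<close>.\<close>
  have approx: "\<exists>x. norm x \<le> 2 * real n \<and> norm (y - f x) < d" if y: "norm y < e" and d: "d > 0" for y d
  proof -
    have near: "\<exists>a. norm a \<le> real n \<and> dist (f a) z < d / 2" if "z \<in> ball y0 e" for z
    proof -
      have "z \<in> closure (f ` cball 0 (real n))" using that e(2) by (auto simp: F_def)
      moreover have "d / 2 > 0" using d by simp
      ultimately obtain w where "w \<in> f ` cball 0 (real n)" "dist w z < d / 2"
        unfolding closure_approachable by blast
      then show ?thesis by auto
    qed
    have "y0 + y \<in> ball y0 e" "y0 \<in> ball y0 e" using e(1) y by (simp_all add: dist_norm)
    then obtain a b where a: "norm a \<le> n" "dist (f a) (y0 + y) < d / 2"
      and b: "norm b \<le> n" "dist (f b) y0 < d / 2"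
      using near by metis
    have "norm (y - f (a - b)) = norm ((f b - y0) - (f a - (y0 + y)))"
      by (simp add: f.diff algebra_simps)
    also have "\<dots> \<le> norm (f b - y0) + norm (f a - (y0 + y))" by (rule norm_triangle_ineq4)
    also have "\<dots> < d" using a b by (simp add: dist_norm)
    finally have "norm (y - f (a - b)) < d" .
    moreover have "norm (a - b) \<le> 2 * real n" using norm_triangle_ineq4[of a b] a b by simp
    ultimately show ?thesis by blast
  qed
  \<comment> \<open>For nonzero \<open>y\<close>, scaling to norm \<open>e / 2\<close> by
    \<open>s\<close> makes \<open>approx\<close> applicable with tolerance \<open>e / 4\<close>;
    scaling back by \<open>1 / s = 2 * norm y / e\<close> turns the bound \<open>2 * n\<close> into
    \<open>K * norm y\<close> and the error into \<open>norm y / 2\<close>.\<close>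
  define K where "K = 4 * real n / e"
  have K: "K \<ge> 0" using e by (simp add: K_def)
  \<comment> \<open>An approximate preimage that halves the error; iterating it sums to an exact one.\<close>
  have half: "\<exists>x. norm x \<le> K * norm y \<and> norm (y - f x) \<le> norm y / 2" for y
  proof (cases "y = 0")
    case True
    then show ?thesis by (intro exI[of _ 0]) (simp add: f.zero)
  next
    case False
    define s where "s = e / (2 * norm y)"
    have s: "s > 0" using e False by (simp add: s_def)
    have "norm (s *\<^sub>R y) < e" using e False by (simp add: s_def)
    then obtain x where x: "norm x \<le> 2 * real n" "norm (s *\<^sub>R y - f x) < e / 4"
      using approx[of "s *\<^sub>R y" "e / 4"] e by auto
    have "norm (x /\<^sub>R s) \<le> K * norm y"
      using x(1) e False by (simp add: s_def K_def field_simps)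
    moreover have "y - f (x /\<^sub>R s) = (s *\<^sub>R y - f x) /\<^sub>R s"
      using s by (simp add: f.scaleR scaleR_diff_right)
    then have "norm (y - f (x /\<^sub>R s)) = norm (s *\<^sub>R y - f x) / s"
      using s by (simp only: norm_scaleR) (simp add: divide_inverse)
    then have "norm (y - f (x /\<^sub>R s)) \<le> (e / 4) / s"
      using divide_right_mono[OF less_imp_le[OF x(2)], of s] s by simp
    then have "norm (y - f (x /\<^sub>R s)) \<le> norm y / 2"
      using e False by (simp add: s_def)
    ultimately show ?thesis by blast
  qed
  then obtain h where h: "\<And>y. norm (h y) \<le> K * norm y" "\<And>y. norm (y - f (h y)) \<le> norm y / 2"
    by metis
  \<comment> \<open>The norms of the corrections sum to at most \<open>2 * K * norm y\<close>; the
    extra 1 keeps the constant positive when \<open>K = 0\<close>.\<close>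
  have "\<exists>x. f x = y \<and> norm x \<le> (2 * K + 1) * norm y" for y
  proof -
    \<comment> \<open>\<open>r k\<close> is the residual after \<open>k\<close> corrections. Since
      \<open>f (h (r k)) = r k - r (Suc k)\<close> and \<open>r\<close> tends to 0, the images of
      the corrections telescope to \<open>y\<close>.\<close>
    define r where "r k = ((\<lambda>z. z - f (h z)) ^^ k) y" for k
    have r0: "r 0 = y" and rS: "r (Suc k) = r k - f (h (r k))" for k by (simp_all add: r_def)
    have r: "norm (r k) \<le> norm y * (1/2) ^ k" for k
    proof (induction k)
      case (Suc k)
      then show ?case using h(2)[of "r k"] by (simp add: rS)
    qed (simp add: r0)
    have hr: "norm (h (r k)) \<le> K * norm y * (1/2) ^ k" for k
      using h(1)[of "r k"] mult_left_mono[OF r[of k] K] by (simp add: mult.assoc)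
    have geo: "(\<lambda>k. K * norm y * (1/2) ^ k) sums (K * norm y * 2)"
      using sums_mult[OF geometric_sums[of "1/2::real"], of "K * norm y"] by simp
    have sum_h: "summable (\<lambda>k. norm (h (r k)))"
      by (rule summable_comparison_test[OF _ sums_summable[OF geo]]) (use hr in auto)
    have "(\<lambda>k. norm y * (1/2) ^ k) \<longlonglongrightarrow> 0"
      using tendsto_mult_right_zero[OF LIMSEQ_power_zero[of "1/2::real"]] by simp
    then have "r \<longlonglongrightarrow> 0"
      by (rule Lim_null_comparison[rotated]) (use r in auto)
    then have "(\<lambda>k. r k - r (Suc k)) sums (r 0 - 0)" by (rule telescope_sums')
    then have "(\<lambda>k. f (h (r k))) sums y" by (simp add: rS r0)
    moreover have "(\<lambda>k. f (h (r k))) sums f (\<Sum>k. h (r k))"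
      using f.sums[OF summable_sums[OF summable_norm_cancel[OF sum_h]]] .
    ultimately have "f (\<Sum>k. h (r k)) = y" by (rule sums_unique2[symmetric])
    moreover have "norm (\<Sum>k. h (r k)) \<le> (\<Sum>k. norm (h (r k)))" by (rule summable_norm[OF sum_h])
    moreover have "(\<Sum>k. norm (h (r k))) \<le> K * norm y * 2"
      using suminf_le[OF hr sum_h sums_summable[OF geo]] sums_unique[OF geo] by simp
    moreover have "K * norm y * 2 \<le> (2 * K + 1) * norm y" by (simp add: algebra_simps)
    ultimately show ?thesis
      by (intro exI[of _ "\<Sum>k. h (r k)"] conjI) (assumption, linarith)
  qed
  then show thesis using that[of "2 * K + 1"] K by simp
qed

section \<open>Inner product estimates and bounded projections\<close>

text \<open>The superclass gives homogeneity of the norm for real scalars; for complex ones it comes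
  from the inner product.\<close>

lemma norm_scaleC:
  fixes x :: "'a::complex_hilbert"
  shows "norm (c *\<^sub>C x) = cmod c * norm x"
proof -
  have "cinner (c *\<^sub>C x) (c *\<^sub>C x) = c * cnj (c * cinner x x)"
    by (metis cinner_commute cinner_scaleC_left)
  also have "\<dots> = (c * cnj c) * cinner x x"
    by (simp add: mult.assoc cinner_commute[of x x, symmetric])
  also have "\<dots> = of_real ((cmod c)\<^sup>2) * cinner x x"
    by (simp only: complex_norm_square)
  finally have "Re (cinner (c *\<^sub>C x) (c *\<^sub>C x)) = (cmod c)\<^sup>2 * Re (cinner x x)"
    by (metis Re_complex_of_real mult.commute times_complex.simps(1) Im_complex_of_real diff_zero mult_zero_left)
  then show ?thesis by (simp add: norm_eq_sqrt_cinner real_sqrt_mult)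
qed

text \<open>Cauchy-Schwarz. The triangle inequality is part of the class, so expanding the square of
  \<open>norm (z + y)\<close> bounds the real part of \<open>cinner z y\<close>; rotating
  \<open>x\<close> by a phase then bounds the modulus.\<close>

lemma norm_cinner_le:
  fixes x y :: "'a::complex_hilbert"
  shows "cmod (cinner x y) \<le> norm x * norm y"
proof -
  have add_right: "cinner z (x + y) = cinner z x + cinner z y" for x y z :: 'a
    by (metis cinner_add_left cinner_commute complex_cnj_add)
  have sq: "(norm z)\<^sup>2 = Re (cinner z z)" for z :: 'a
    by (simp add: norm_eq_sqrt_cinner cinner_ge_zero)
  have re: "Re (cinner z y) \<le> norm z * norm y" for z
  proof -
    have "(norm (z + y))\<^sup>2 = (norm z)\<^sup>2 + (norm y)\<^sup>2 + 2 * Re (cinner z y)"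
      using cinner_commute[of y z] by (simp add: sq cinner_add_left add_right)
    moreover have "(norm (z + y))\<^sup>2 \<le> (norm z + norm y)\<^sup>2"
      by (intro power_mono norm_triangle_ineq) simp
    ultimately show ?thesis by (simp add: power2_sum)
  qed
  \<comment> \<open>The conjugate phase makes \<open>cinner (c *\<^sub>C x) y\<close> real and
    nonnegative. If \<open>cinner x y = 0\<close> then \<open>c = 0\<close>, so
    \<open>cmod c\<close> is 0 or 1.\<close>
  define c where "c = cnj (sgn (cinner x y))"
  have "cinner (c *\<^sub>C x) y = of_real (cmod (cinner x y))"
  proof (cases "cinner x y = 0")
    case False
    then show ?thesis
      using complex_norm_square[of "cinner x y"]
      by (simp add: c_def cinner_scaleC_left sgn_eq divide_simps power2_eq_square mult.commute)
  qed (simp add: cinner_scaleC_left)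
  then have "cmod (cinner x y) = Re (cinner (c *\<^sub>C x) y)" by simp
  also have "\<dots> \<le> cmod c * norm x * norm y" using re[of "c *\<^sub>C x"] by (simp add: norm_scaleC)
  also have "\<dots> \<le> norm x * norm y"
    by (simp add: c_def norm_sgn)
  finally show ?thesis .
qed

lemma linear_bounded_ops:
  "T \<in> bounded_ops \<Longrightarrow> Vector_Spaces.linear scaleC scaleC (blinfun_apply T)"
  by unfold_locales (auto simp: bounded_ops_def blinfun.add_right)

text \<open>Induction on a finite spanning set: a new vector outside the span is absorbed by adding
  a rank-one term built from \<open>cinner\<close>. The result serves for the null space of a
  Fredholm operator and for a complement of its range.\<close>

lemma bounded_projection_exists:
  fixes V :: "'a::complex_hilbert set"
  assumes "complex_vector.subspace V" "cfinite_dim V"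
  obtains P :: "'a \<Rightarrow>\<^sub>L 'a" where "P \<in> bounded_ops" "range (blinfun_apply P) = V"
    "\<And>x. x \<in> V \<Longrightarrow> P x = x"
proof -
  have span: "\<exists>P::'a \<Rightarrow>\<^sub>L 'a. P \<in> bounded_ops \<and> range (blinfun_apply P) = complex_vector.span B \<and>
      (\<forall>x\<in>complex_vector.span B. P x = x)" if "finite B" for B
    using that
  proof induction
    case empty
    show ?case by (rule exI[of _ 0]) (auto simp: bounded_ops_def)
  next
    case (insert b B)
    then obtain P :: "'a \<Rightarrow>\<^sub>L 'a" where P: "P \<in> bounded_ops"
      "range (blinfun_apply P) = complex_vector.span B" "\<And>x. x \<in> complex_vector.span B \<Longrightarrow> P x = x"
      by blast
    \<comment> \<open>\<open>u\<close> is the part of \<open>b\<close> that \<open>P\<close>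
      annihilates; it is 0 exactly when \<open>b\<close> already lies in the span of
      \<open>B\<close>.\<close>
    define u where "u = b - P b"
    show ?case
    proof (cases "u = 0")
      case True
      then have "b \<in> complex_vector.span B" using P(2) by (metis eq_iff_diff_eq_0 rangeI u_def)
      then have "complex_vector.span (insert b B) = complex_vector.span B"
        by (rule complex_vector.span_redundant)
      then show ?thesis using P by metis
    next
      case False
      \<comment> \<open>A bounded functional with \<open>f u = 1\<close> that vanishes on the range
        of \<open>P\<close>: the argument \<open>y - P y\<close> removes that range, whether or not
        \<open>P\<close> is orthogonal.\<close>
      define f where "f y = cinner (y - P y) u / cinner u u" for y
      have Pc: "P (c *\<^sub>C x) = c *\<^sub>C P x" for c x using P(1) by (simp add: bounded_ops_def)
      have PP: "P (P x) = P x" for x using P(2,3) by blast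
      have f_add: "f (x + y) = f x + f y" for x y
        by (simp add: f_def blinfun.add_right add_diff_add cinner_add_left add_divide_distrib)
      have f_scale: "f (c *\<^sub>C x) = c * f x" for c x
        by (simp add: f_def Pc cinner_scaleC_left flip: complex_vector.scale_right_diff_distrib)
      have f_u: "f u = 1"
        using False by (simp add: f_def u_def blinfun.diff_right PP cinner_eq_zero_iff)
      have f_P: "f (P x) = 0" for x
        using cinner_scaleC_left[of 0 0 u] by (simp add: f_def PP)
      have f_bound: "cmod (f y) \<le> norm y * ((1 + norm P) * norm u / cmod (cinner u u))" for y
      proof -
        have "norm (y - P y) \<le> norm y + norm P * norm y"
          using norm_triangle_ineq4[of y "P y"] norm_blinfun[of P y] by linarith
        then have "cmod (cinner (y - P y) u) \<le> (norm y + norm P * norm y) * norm u"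
          using norm_cinner_le[of "y - P y" u] by (meson mult_right_mono norm_ge_zero order_trans)
        then show ?thesis
          by (simp add: f_def norm_divide divide_right_mono algebra_simps)
      qed
      have bl: "bounded_linear (\<lambda>y. P y + f y *\<^sub>C u)"
      proof (intro bounded_linear_add blinfun.bounded_linear_right bounded_linear_intro)
        show "f (x + y) *\<^sub>C u = f x *\<^sub>C u + f y *\<^sub>C u" for x y
          by (simp add: f_add complex_vector.scale_left_distrib)
        show "f (r *\<^sub>R x) *\<^sub>C u = r *\<^sub>R (f x *\<^sub>C u)" for r x
          by (simp add: scaleR_scaleC f_scale)
        show "norm (f x *\<^sub>C u) \<le> norm x * (((1 + norm P) * norm u / cmod (cinner u u)) * norm u)" for x
          using mult_right_mono[OF f_bound[of x] norm_ge_zero[of u]] by (simp add: norm_scaleC mult.assoc)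
      qed
      define Q where "Q = Blinfun (\<lambda>y. P y + f y *\<^sub>C u)"
      have Q: "Q y = P y + f y *\<^sub>C u" for y
        unfolding Q_def by (simp add: bounded_linear_Blinfun_apply[OF bl])
      have spanB: "complex_vector.span B \<subseteq> complex_vector.span (insert b B)"
        by (intro complex_vector.span_mono) auto
      have Pspan: "P y \<in> complex_vector.span (insert b B)" for y using P(2) spanB by blast
      then have uspan: "u \<in> complex_vector.span (insert b B)"
        unfolding u_def by (intro complex_vector.span_diff) (auto intro: complex_vector.span_base)
      have Qc: "Q \<in> bounded_ops"
        by (simp add: bounded_ops_def Q Pc f_scale complex_vector.scale_right_distrib)
      interpret Q: Vector_Spaces.linear scaleC scaleC "blinfun_apply Q"
        by (rule linear_bounded_ops[OF Qc])
      have Q_id: "Q x = x" if x: "x \<in> complex_vector.span (insert b B)" for x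
      proof -
        obtain k where k: "x - k *\<^sub>C b \<in> complex_vector.span B"
          using x complex_vector.span_breakdown_eq[of x b B] by blast
        \<comment> \<open>\<open>Q\<close> fixes the range of \<open>P\<close> and fixes
          \<open>u\<close>, hence also \<open>b = u + P b\<close> and the whole enlarged
          span.\<close>
        have QP: "Q (P y) = P y" for y by (simp add: Q f_P PP)
        have "Q u = u" by (simp add: Q f_u) (simp add: u_def blinfun.diff_right PP)
        then have "Q b = b" using QP[of b] by (simp add: u_def blinfun.diff_right)
        moreover have "Q (x - k *\<^sub>C b) = x - k *\<^sub>C b" using k QP P(3) by metis
        ultimately show ?thesis by (simp add: Q.diff Q.scale)
      qed
      have "Q y \<in> complex_vector.span (insert b B)" for y
        unfolding Q using Pspan uspan
        by (intro complex_vector.span_add complex_vector.span_scale)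
      then have "range (blinfun_apply Q) = complex_vector.span (insert b B)"
        using Q_id by (metis image_subsetI rangeI subsetI subset_antisym)
      then show ?thesis using Qc Q_id by blast
    qed
  qed
  obtain D where D: "finite D" "V \<subseteq> complex_vector.span D"
    using assms(2) by (auto simp: cfinite_dim_def)
  obtain B where B: "B \<subseteq> V" "complex_vector.independent B" "V \<subseteq> complex_vector.span B"
    using complex_vector.basis_exists by metis
  have "finite B" using D B complex_vector.independent_span_bound by blast
  moreover have "complex_vector.span B = V"
    using B assms(1) complex_vector.span_minimal by blast
  ultimately show thesis using span[of B] that by blast
qed

section \<open>Subspaces, dimensions and algebraic complements\<close>

lemma subspace_image_bounded_ops:
  assumes "T \<in> bounded_ops" "complex_vector.subspace M"
  shows "complex_vector.subspace (blinfun_apply T ` M)"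
proof -
  interpret Vector_Spaces.linear scaleC scaleC "blinfun_apply T"
    by (rule linear_bounded_ops[OF assms(1)])
  show ?thesis by (rule subspace_image[OF assms(2)])
qed

lemma subspace_null_space:
  assumes "T \<in> bounded_ops"
  shows "complex_vector.subspace (null_space T)"
proof -
  interpret Vector_Spaces.linear scaleC scaleC "blinfun_apply T"
    by (rule linear_bounded_ops[OF assms])
  show ?thesis unfolding null_space_def by (rule subspace_kernel)
qed

lemma inj_on_subspace_bounded_ops:
  assumes "T \<in> bounded_ops" "complex_vector.subspace M" "M \<inter> null_space T = {0}"
  shows "inj_on (blinfun_apply T) M"
proof (rule inj_onI)
  fix x y assume "x \<in> M" "y \<in> M" "T x = T y"
  then have "x - y \<in> M \<inter> null_space T"
    using assms(2) by (auto simp: null_space_def blinfun.diff_right complex_vector.subspace_diff)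
  then show "x = y" using assms(3) by simp
qed

lemma cfinite_dim_basis:
  assumes "cfinite_dim V"
  obtains B where "B \<subseteq> V" "complex_vector.independent B" "V \<subseteq> complex_vector.span B"
    "finite B" "card B = complex_vector.dim V"
proof -
  obtain B where B: "B \<subseteq> V" "complex_vector.independent B" "V \<subseteq> complex_vector.span B"
    "card B = complex_vector.dim V"
    using complex_vector.basis_exists by blast
  moreover obtain D where "finite D" "V \<subseteq> complex_vector.span D"
    using assms by (auto simp: cfinite_dim_def)
  ultimately show thesis using complex_vector.independent_span_bound[of D B] that by blast
qed

lemma cfinite_dim_subset: "cfinite_dim V \<Longrightarrow> U \<subseteq> V \<Longrightarrow> cfinite_dim U"
  by (auto simp: cfinite_dim_def)

lemma cdim_direct_sum:
  assumes "complex_vector.subspace U" "complex_vector.subspace V" "U \<inter> V = {0}"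
    and "cfinite_dim U" "cfinite_dim V"
  shows "cfinite_dim {u + v |u v. u \<in> U \<and> v \<in> V}" (is "cfinite_dim ?S")
    and "complex_vector.dim {u + v |u v. u \<in> U \<and> v \<in> V} =
      complex_vector.dim U + complex_vector.dim V"
proof -
  obtain B where B: "B \<subseteq> U" "complex_vector.independent B" "U \<subseteq> complex_vector.span B"
    "finite B" "card B = complex_vector.dim U"
    using cfinite_dim_basis[OF assms(4)] .
  obtain C where C: "C \<subseteq> V" "complex_vector.independent C" "V \<subseteq> complex_vector.span C"
    "finite C" "card C = complex_vector.dim V"
    using cfinite_dim_basis[OF assms(5)] .
  have sB: "complex_vector.span B = U" and sC: "complex_vector.span C = V"
    using B C assms(1,2) complex_vector.span_minimal by blast+
  have S: "?S = complex_vector.span (B \<union> C)"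
    by (simp add: complex_vector.span_Un sB sC)
  then show "cfinite_dim ?S" using B(4) C(4) by (auto simp: cfinite_dim_def)
  have "B \<inter> C = {}"
  proof -
    have "B \<inter> C \<subseteq> {0}" using B(1) C(1) assms(3) by blast
    moreover have "0 \<notin> B" using B(2) complex_vector.dependent_zero by blast
    ultimately show ?thesis by blast
  qed
  then have "card (B \<union> C) = complex_vector.dim U + complex_vector.dim V"
    using B C by (simp add: card_Un_disjoint)
  moreover have "complex_vector.independent (B \<union> C)"
    by (intro complex_vector.independent_Un_disjoint_spans) (simp_all add: B C sB sC assms(3))
  ultimately show "complex_vector.dim ?S = complex_vector.dim U + complex_vector.dim V"
    by (simp add: S complex_vector.dim_eq_card_independent)
qed

lemma cdim_image:
  assumes T: "T \<in> bounded_ops" and "complex_vector.subspace V" "inj_on (blinfun_apply T) V"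
    and "cfinite_dim V"
  shows "cfinite_dim (blinfun_apply T ` V)"
    and "complex_vector.dim (blinfun_apply T ` V) = complex_vector.dim V"
proof -
  interpret T: Vector_Spaces.linear scaleC scaleC "blinfun_apply T"
    by (rule linear_bounded_ops[OF T])
  obtain B where B: "B \<subseteq> V" "complex_vector.independent B" "V \<subseteq> complex_vector.span B"
    "finite B" "card B = complex_vector.dim V"
    using cfinite_dim_basis[OF assms(4)] .
  have sB: "complex_vector.span B = V"
    using B assms(2) complex_vector.span_minimal by blast
  have im: "blinfun_apply T ` V = complex_vector.span (blinfun_apply T ` B)"
    by (simp add: T.span_image sB)
  then show "cfinite_dim (blinfun_apply T ` V)" using B(4) by (auto simp: cfinite_dim_def)
  have "complex_vector.independent (blinfun_apply T ` B)"
    using T.independent_injective_image[OF B(2)] assms(3) sB by simp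
  moreover have "card (blinfun_apply T ` B) = card B"
    using assms(3) B(1) by (meson card_image inj_on_subset)
  ultimately show "complex_vector.dim (blinfun_apply T ` V) = complex_vector.dim V"
    by (simp add: im complex_vector.dim_eq_card_independent B(5))
qed

text \<open>The identity of \<open>M\<close> extends to a linear map \<open>g\<close> of the whole
  space into \<open>M\<close>, an algebraic projection with no continuity claimed; its kernel is the
  complement.\<close>

lemma ccomplement_exists:
  fixes M :: "'a::complex_hilbert set"
  assumes "complex_vector.subspace M"
  obtains W where "ccomplement M W"
proof -
  interpret P: vector_space_pair "scaleC :: complex \<Rightarrow> 'a \<Rightarrow> 'a" "scaleC :: complex \<Rightarrow> 'a \<Rightarrow> 'a" ..
  obtain g :: "'a \<Rightarrow> 'a" where g: "range g \<subseteq> M" "Vector_Spaces.linear scaleC scaleC g" "\<And>v. v \<in> M \<Longrightarrow> g v = v"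
    using P.linear_exists_left_inverse_on[OF complex_vector.linear_id assms] by auto
  interpret g: Vector_Spaces.linear scaleC scaleC g by fact
  have "ccomplement M {x. g x = 0}"
    unfolding ccomplement_def
  proof (intro conjI allI)
    show "complex_vector.subspace {x. g x = 0}" by (rule g.subspace_kernel)
    show "M \<inter> {x. g x = 0} = {0}"
      using g(3) g.zero complex_vector.subspace_0[OF assms] by force
    fix x
    have "g (x - g x) = 0" using g(1,3) by (simp add: g.diff image_subset_iff)
    then show "\<exists>m\<in>M. \<exists>w\<in>{x. g x = 0}. x = m + w"
      using g(1) by (intro bexI[of _ "g x"] bexI[of _ "x - g x"]) auto
  qed
  then show thesis by (rule that)
qed

section \<open>The index computed from complements\<close>

text \<open>Restricted to \<open>M\<close>, the operator is injective with cokernel of dimension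
  \<open>dim W\<close>, and extending it from \<open>M\<close> to the whole space raises the index
  by \<open>dim N\<close>. The right-hand side is free of \<open>S\<close>, so operators sharing
  \<open>M\<close>, \<open>N\<close> and \<open>W\<close> have equal index.\<close>

lemma fredholm_index_eq:
  fixes S :: "'a::complex_hilbert \<Rightarrow>\<^sub>L 'a"
  assumes S: "S \<in> Fred" and M: "complex_vector.subspace M"
    and N: "ccomplement M N" "cfinite_dim N"
    and inj: "M \<inter> null_space S = {0}"
    and W: "ccomplement (blinfun_apply S ` M) W" "cfinite_dim W"
  shows "fredholm_index S = int (complex_vector.dim N) - int (complex_vector.dim W)"
proof -
  \<comment> \<open>With \<open>K = N(S)\<close>, \<open>U\<close> a complement of \<open>M + K\<close> and \<open>V\<close> a complement of \<open>R(S)\<close>, both \<open>N\<close> and \<open>K + U\<close>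
    are complements of \<open>M\<close>, and both \<open>W\<close> and \<open>S(U) + V\<close> are complements of \<open>S(M)\<close>; so the terms
    \<open>dim U = dim S(U)\<close> cancel in \<open>dim N - dim W\<close>.\<close>
  define K where "K = null_space S"
  have Sb: "S \<in> bounded_ops" and Kfin: "cfinite_dim K" using S by (simp_all add: Fred_def K_def)
  obtain V where V: "ccomplement (range (blinfun_apply S)) V" "cfinite_dim V"
    using S by (auto simp: Fred_def cfinite_codim_def)
  have sK: "complex_vector.subspace K" unfolding K_def by (rule subspace_null_space[OF Sb])
  have SK: "S k = 0" if "k \<in> K" for k using that by (simp add: K_def null_space_def)
  define D where "D = {m + k |m k. m \<in> M \<and> k \<in> K}"
  have sD: "complex_vector.subspace D"
    unfolding D_def by (rule complex_vector.subspace_sums[OF M sK])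
  then obtain U where U: "ccomplement D U" by (rule ccomplement_exists)
  have sU: "complex_vector.subspace U" and DU: "D \<inter> U = {0}" using U by (simp_all add: ccomplement_def)
  have sV: "complex_vector.subspace V" and RV: "range (blinfun_apply S) \<inter> V = {0}"
    using V by (simp_all add: ccomplement_def)
  have MD: "M \<subseteq> D" and KD: "K \<subseteq> D"
    using complex_vector.subspace_0[OF M] complex_vector.subspace_0[OF sK] by (force simp: D_def)+
  have split: "\<exists>m\<in>M. \<exists>k\<in>K. \<exists>u\<in>U. x = m + k + u" for x
    using U unfolding ccomplement_def D_def by fastforce
  have KU: "K \<inter> U = {0}"
    using DU KD complex_vector.subspace_0[OF sK] complex_vector.subspace_0[OF sU] by blast
  have cN: "ccomplement M {k + u |k u. k \<in> K \<and> u \<in> U}" (is "ccomplement M ?KU")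
    unfolding ccomplement_def
  proof (intro conjI allI)
    show sKU: "complex_vector.subspace ?KU" by (rule complex_vector.subspace_sums[OF sK sU])
    \<comment> \<open>Since \<open>x\<close> and \<open>k\<close> lie in \<open>D\<close>, so does
      \<open>u\<close>; thus \<open>u = 0\<close>, and \<open>x = k\<close> lies in both
      \<open>M\<close> and the null space.\<close>
    have "x = 0" if x: "x \<in> M" "x = k + u" "k \<in> K" "u \<in> U" for x k u
    proof -
      have "u = x - k" using x by simp
      then have "u \<in> D"
        using x(1,3) MD KD complex_vector.subspace_diff[OF sD] by blast
      then have "u = 0" using x(4) DU by blast
      then show ?thesis using x inj by (auto simp: K_def)
    qed
    then show "M \<inter> ?KU = {0}"
      using complex_vector.subspace_0[OF M] complex_vector.subspace_0[OF sKU] by blast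
    show "\<exists>m\<in>M. \<exists>w\<in>?KU. x = m + w" for x
      using split[of x] by (metis (mono_tags, lifting) add.assoc mem_Collect_eq)
  qed
  \<comment> \<open>Any complement of \<open>M\<close> is finite-dimensional because
    \<open>N\<close> is; this is where finiteness of \<open>dim U\<close> comes from.\<close>
  have fKU: "cfinite_dim ?KU" using ccomplement_dim_le[OF M cN N] by blast
  have "U \<subseteq> ?KU" using complex_vector.subspace_0[OF sK] by force
  then have fU: "cfinite_dim U" using fKU cfinite_dim_subset by blast
  have dN: "complex_vector.dim N = complex_vector.dim K + complex_vector.dim U"
    using ccodim_eq[OF M N] ccodim_eq[OF M cN fKU] cdim_direct_sum(2)[OF sK sU KU Kfin fU] by simp
  have injU: "inj_on (blinfun_apply S) U"
    using inj_on_subspace_bounded_ops[OF Sb sU] KU by (simp add: K_def Int_commute)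
  have sSM: "complex_vector.subspace (blinfun_apply S ` M)"
    and sSU: "complex_vector.subspace (blinfun_apply S ` U)"
    by (intro subspace_image_bounded_ops Sb M sU)+
  have SUV: "blinfun_apply S ` U \<inter> V = {0}"
    using RV complex_vector.subspace_0[OF sSU] complex_vector.subspace_0[OF sV] by blast
  have cW: "ccomplement (blinfun_apply S ` M) {y + v |y v. y \<in> blinfun_apply S ` U \<and> v \<in> V}"
    (is "ccomplement _ ?SUV")
    unfolding ccomplement_def
  proof (intro conjI allI)
    show sSUV: "complex_vector.subspace ?SUV" by (rule complex_vector.subspace_sums[OF sSU sV])
    \<comment> \<open>Here \<open>v\<close> lies in the range and in \<open>V\<close>, so
      \<open>v = 0\<close> and \<open>m - u\<close> lies in \<open>K\<close>; then \<open>u\<close>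
      lies in both \<open>D\<close> and \<open>U\<close>, so \<open>u = 0\<close>.\<close>
    have "S m = 0" if m: "m \<in> M" "S m = S u + v" "u \<in> U" "v \<in> V" for m u v
    proof -
      have "v = S (m - u)" using m by (simp add: blinfun.diff_right)
      then have "S (m - u) = 0" using m(4) RV by blast
      then have "m - u \<in> D" using KD by (auto simp: K_def null_space_def)
      then have "m - (m - u) \<in> D"
        using m(1) MD complex_vector.subspace_diff[OF sD] by blast
      then have "u \<in> D" by simp
      then have "u = 0" using m(3) DU by blast
      then show ?thesis using \<open>S (m - u) = 0\<close> by simp
    qed
    then show "blinfun_apply S ` M \<inter> ?SUV = {0}"
      using complex_vector.subspace_0[OF sSM] complex_vector.subspace_0[OF sSUV] by blast
    fix x
    obtain y v where yv: "v \<in> V" "x = S y + v"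
      using V(1) unfolding ccomplement_def by blast
    obtain m k u where mku: "m \<in> M" "k \<in> K" "u \<in> U" "y = m + k + u" using split by blast
    have "x = S m + (S u + v)"
      using yv mku SK by (simp add: blinfun.add_right add.assoc)
    then show "\<exists>y\<in>blinfun_apply S ` M. \<exists>w\<in>?SUV. x = y + w"
      using yv(1) mku(1,3) by blast
  qed
  note dSU = cdim_image[OF Sb sU injU fU]
  note dSUV = cdim_direct_sum[OF sSU sV SUV dSU(1) V(2)]
  have "complex_vector.dim W = complex_vector.dim U + complex_vector.dim V"
    using ccodim_eq[OF sSM W] ccodim_eq[OF sSM cW dSUV(1)] dSUV(2) dSU(2) by simp
  moreover have "ccodim (range (blinfun_apply S)) = complex_vector.dim V"
    by (intro ccodim_eq V subspace_image_bounded_ops Sb complex_vector.subspace_UNIV)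
  ultimately show ?thesis using dN by (simp add: fredholm_index_def K_def)
qed

section \<open>Local constancy of the index\<close>

lemma fredholm_index_locally_constant:
  fixes T :: "'a::complex_hilbert \<Rightarrow>\<^sub>L 'a"
  assumes T: "T \<in> Fred"
  obtains e where "e > 0" "\<And>S. S \<in> Fred \<Longrightarrow> dist S T < e \<Longrightarrow> fredholm_index S = fredholm_index T"
proof -
  define N where "N = null_space T"
  have Tb: "T \<in> bounded_ops" and N: "cfinite_dim N" using T by (simp_all add: Fred_def N_def)
  have sN: "complex_vector.subspace N" unfolding N_def by (rule subspace_null_space[OF Tb])
  obtain W where W: "ccomplement (range (blinfun_apply T)) W" "cfinite_dim W"
    using T by (auto simp: Fred_def cfinite_codim_def)
  have sW: "complex_vector.subspace W" and TW: "range (blinfun_apply T) \<inter> W = {0}"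
    using W by (simp_all add: ccomplement_def)
  obtain P :: "'a \<Rightarrow>\<^sub>L 'a" where P: "P \<in> bounded_ops" "range (blinfun_apply P) = N" "\<And>x. x \<in> N \<Longrightarrow> P x = x"
    using bounded_projection_exists[OF sN N] by blast
  obtain Q :: "'a \<Rightarrow>\<^sub>L 'a" where Q: "Q \<in> bounded_ops" "range (blinfun_apply Q) = W" "\<And>x. x \<in> W \<Longrightarrow> Q x = x"
    using bounded_projection_exists[OF sW W(2)] by blast
  define M where "M = null_space P"
  have sM: "complex_vector.subspace M" unfolding M_def by (rule subspace_null_space[OF P(1)])
  have PN: "P x \<in> N" for x using P(2) by (metis rangeI)
  have MP: "x - P x \<in> M" for x
    using P(3)[OF PN[of x]] by (simp add: M_def null_space_def blinfun.diff_right)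
  have TP: "T (P x) = 0" for x
    using PN[of x] by (simp add: N_def null_space_def)
  have MN: "M \<inter> N = {0}"
  proof -
    have "x = 0" if "x \<in> M" "x \<in> N" for x
      using that(1) P(3)[OF that(2)] by (simp add: M_def null_space_def)
    then show ?thesis
      using complex_vector.subspace_0[OF sM] complex_vector.subspace_0[OF sN] by blast
  qed
  have cMN: "ccomplement M N"
    unfolding ccomplement_def
  proof (intro conjI allI sN MN)
    fix x
    have "x = (x - P x) + P x" by simp
    then show "\<exists>m\<in>M. \<exists>n\<in>N. x = m + n" using MP P(2) by blast
  qed
  \<comment> \<open>The projections extend \<open>(m, w) \<mapsto> T m + w\<close> from \<open>M \<times> W\<close> to the Banach type \<open>'a \<times> 'a\<close>.\<close>
  define L where "L z = T (fst z - P (fst z)) + Q (snd z)" for z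
  have "bounded_linear L"
    unfolding L_def
    by (intro bounded_linear_add bounded_linear_sub bounded_linear_fst bounded_linear_snd
        bounded_linear_compose[OF blinfun.bounded_linear_right])
  moreover have "surj L"
  proof -
    have "\<exists>z. y = L z" for y
    proof -
      obtain x w where "y = T x + w" "w \<in> W" using W(1) unfolding ccomplement_def by blast
      then show ?thesis
        using Q(3) by (intro exI[of _ "(x, w)"]) (simp add: L_def blinfun.diff_right TP)
    qed
    then show ?thesis by blast
  qed
  ultimately obtain C where C: "C > 0" "\<And>y. \<exists>z. L z = y \<and> norm z \<le> C * norm y"
    using open_mapping_bound by blast
  \<comment> \<open>\<open>C\<close> bounds the first component of a preimage under
    \<open>L\<close>; passing from \<open>fst z\<close> to its component in \<open>M\<close> costs
    the factor \<open>1 + norm P\<close>.\<close>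
  define C' where "C' = (1 + norm P) * C"
  have C': "C' > 0" using C(1) by (simp add: C'_def add_pos_nonneg)
  have "\<exists>m w. m \<in> M \<and> w \<in> W \<and> T m + w = y \<and> norm m \<le> C' * norm y" for y
  proof -
    obtain z where z: "L z = y" "norm z \<le> C * norm y" using C(2) by blast
    have "norm (fst z) \<le> C * norm y" using z(2) norm_fst_le[of "fst z" "snd z"] by simp
    moreover have "norm (fst z - P (fst z)) \<le> (1 + norm P) * norm (fst z)"
      using norm_triangle_ineq4[of "fst z" "P (fst z)"] norm_blinfun[of P "fst z"]
      by (simp add: algebra_simps)
    ultimately have "norm (fst z - P (fst z)) \<le> C' * norm y"
      unfolding C'_def mult.assoc by (meson add_nonneg_nonneg mult_left_mono norm_ge_zero order_trans zero_le_one)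
    moreover have "Q (snd z) \<in> W" using Q(2) by blast
    ultimately show ?thesis using MP z(1) unfolding L_def by blast
  qed
  then obtain g h where g: "\<And>y. g y \<in> M" "\<And>y. h y \<in> W" "\<And>y. T (g y) + h y = y"
      "\<And>y. norm (g y) \<le> C' * norm y"
    by metis
  have uniq: "m = m'" if m: "m \<in> M" "m' \<in> M" "w \<in> W" "w' \<in> W" "T m + w = T m' + w'" for m m' w w'
  proof -
    have "T (m - m') = w' - w" using m(5) by (simp add: blinfun.diff_right algebra_simps)
    moreover have "w' - w \<in> W" using m complex_vector.subspace_diff[OF sW] by blast
    ultimately have "T (m - m') = 0" using TW by (metis Int_iff rangeI singletonD)
    moreover have "m - m' \<in> M" using m complex_vector.subspace_diff[OF sM] by blast
    ultimately have "m - m' \<in> M \<inter> N" by (simp add: N_def null_space_def)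
    then show ?thesis using MN by simp
  qed
  \<comment> \<open>\<open>g\<close> was obtained by choice; uniqueness of the decomposition makes
    it additive, which turns the norm bound on \<open>g\<close> into a Lipschitz bound.\<close>
  have g_diff: "g (x - y) = g x - g y" for x y
  proof -
    have M: "g x - g y \<in> M" and W: "h x - h y \<in> W"
      using g(1,2) complex_vector.subspace_diff sM sW by blast+
    have "T (g (x - y)) + h (x - y) = T (g x - g y) + (h x - h y)"
      using g(3)[of x] g(3)[of y] g(3)[of "x - y"] by (simp add: blinfun.diff_right algebra_simps)
    then show ?thesis by (rule uniq[OF g(1) M g(2) W])
  qed
  have index: "fredholm_index S = int (complex_vector.dim N) - int (complex_vector.dim W)"
    if S: "S \<in> Fred" and ST: "dist S T < 1 / C'" for S
  proof (rule fredholm_index_eq[OF S sM cMN N _ _ W(2)])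
    have Sb: "S \<in> bounded_ops" using S by (simp add: Fred_def)
    \<comment> \<open>A Lipschitz constant of \<open>y \<mapsto> S (g y) - T (g y)\<close>; the
      radius \<open>1 / C'\<close> makes it less than 1.\<close>
    define c where "c = norm (S - T) * C'"
    have c: "0 \<le> c" "c < 1" using C' ST by (simp_all add: c_def dist_norm field_simps)
    have contr: "norm (S (g y) - T (g y)) \<le> c * norm y" for y
    proof -
      have "norm (S (g y) - T (g y)) \<le> norm (S - T) * norm (g y)"
        by (metis blinfun.diff_left norm_blinfun)
      also have "\<dots> \<le> c * norm y"
        unfolding c_def mult.assoc by (intro mult_left_mono g) simp
      finally show ?thesis .
    qed
    have S0: "m = 0" if m: "m \<in> M" "w \<in> W" "S m + w = 0" for m w
    proof -
      \<comment> \<open>With this \<open>y\<close>, uniqueness gives \<open>g y = m\<close>, so the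
        perturbation \<open>S (g y) - T (g y)\<close> equals \<open>- y\<close>; as
        \<open>c < 1\<close>, this forces \<open>y = 0\<close>.\<close>
      define y where "y = T m + w"
      have "g y = m" using uniq[OF g(1) m(1) g(2) m(2) g(3)[of y, unfolded y_def]] by (simp add: y_def)
      moreover have "S m = - w" using m(3) by (simp add: eq_neg_iff_add_eq_0)
      ultimately have "S (g y) - T (g y) = - y" by (simp add: y_def)
      then have "norm y \<le> c * norm y" using contr[of y] by simp
      then have "y = 0" using mult_strict_right_mono[OF c(2), of "norm y"] by fastforce
      then show ?thesis using g(4)[of y] \<open>g y = m\<close> by simp
    qed
    show "M \<inter> null_space S = {0}"
      using S0[of _ 0] complex_vector.subspace_0[OF sM] complex_vector.subspace_0[OF sW]
      by (auto simp: null_space_def)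
    show "ccomplement (blinfun_apply S ` M) W"
      unfolding ccomplement_def
    proof (intro conjI allI sW)
      have "S m = 0" if "m \<in> M" "S m \<in> W" for m
        using S0[OF that(1) complex_vector.subspace_neg[OF sW that(2)]] by simp
      then show "blinfun_apply S ` M \<inter> W = {0}"
        using complex_vector.subspace_0[OF subspace_image_bounded_ops[OF Sb sM]]
          complex_vector.subspace_0[OF sW] by blast
      fix y
      \<comment> \<open>A fixed point \<open>u\<close> satisfies
        \<open>y = S (g u) + (u - T (g u))\<close>, and the last term is \<open>h u\<close>, an
        element of \<open>W\<close>.\<close>
      have "\<exists>!u. y - (S (g u) - T (g u)) = u"
      proof (rule banach_fix_type[OF c], intro allI)
        fix u v
        have "(y - (S (g u) - T (g u))) - (y - (S (g v) - T (g v))) = - (S (g (u - v)) - T (g (u - v)))"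
          by (simp add: g_diff blinfun.diff_right)
        then show "dist (y - (S (g u) - T (g u))) (y - (S (g v) - T (g v))) \<le> c * dist u v"
          unfolding dist_norm using contr[of "u - v"] by (metis norm_minus_cancel)
      qed
      then obtain u where "y - (S (g u) - T (g u)) = u" by blast
      then have "y = S (g u) + (u - T (g u))" by (simp add: algebra_simps)
      moreover have "u - T (g u) = h u" using g(3)[of u] by (metis add_diff_cancel_left')
      ultimately have "y = S (g u) + h u" by simp
      then show "\<exists>m\<in>blinfun_apply S ` M. \<exists>w\<in>W. y = m + w" using g(1,2) by blast
    qed
  qed
  show thesis
  proof (rule that[of "1 / C'"])
    \<comment> \<open>\<open>T\<close> itself lies within the radius, so the formula for nearby
      operators gives its index too.\<close>
    show "fredholm_index S = fredholm_index T" if "S \<in> Fred" "dist S T < 1 / C'" for S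
      using index[OF that] index[OF T] C' by simp
  qed (use C' in simp)
qed

section \<open>Invariance along a homotopy\<close>

theorem theorem2p10:
  fixes X :: "'x topology"
    and S T :: "'x \<Rightarrow> ('h::complex_hilbert \<Rightarrow>\<^sub>L 'h)"
  assumes "separable_space (euclidean :: 'h topology)"
    and "\<not> cfinite_dim (UNIV :: 'h set)"
    and "countable (connected_components_of X)"
    and "continuous_map X (top_of_set Fred) S"
    and "continuous_map X (top_of_set Fred) T"
    and "fredholm_homotopic X S T"
  shows "family_index X T = family_index X S"
proof -
  obtain \<Phi> where cont: "continuous_map (prod_topology (top_of_set {0..1::real}) X) (top_of_set bounded_ops) \<Phi>"
    and \<Phi>: "\<And>t x. t \<in> {0..1} \<Longrightarrow> x \<in> topspace X \<Longrightarrow> \<Phi> (0, x) = S x \<and> \<Phi> (1, x) = T x \<and> \<Phi> (t, x) \<in> Fred"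
    using assms(6) unfolding fredholm_homotopic_def by blast
  have index: "fredholm_index (T x) = fredholm_index (S x)" if x: "x \<in> topspace X" for x
  proof -
    have "continuous_map (top_of_set {0..1}) (prod_topology (top_of_set {0..1::real}) X) (\<lambda>t. (t, x))"
      using x by (intro continuous_map_pairedI) auto
    then have "continuous_map (top_of_set {0..1}) (top_of_set bounded_ops) (\<lambda>t. \<Phi> (t, x))"
      using continuous_map_compose[OF _ cont] by (force simp: o_def)
    then have path: "continuous_on {0..1} (\<lambda>t. \<Phi> (t, x))"
      by (simp add: continuous_map_in_subtopology)
    have "fredholm_index (\<Phi> (0, x)) = fredholm_index (\<Phi> (1, x))"
    proof (rule connected_local_const[where A="{0..1}" and f="\<lambda>t. fredholm_index (\<Phi> (t, x))"])
      show "\<forall>t\<in>{0..1}. \<forall>\<^sub>F s in at t within {0..1}. fredholm_index (\<Phi> (t, x)) = fredholm_index (\<Phi> (s, x))"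
      proof
        fix t :: real assume t: "t \<in> {0..1}"
        obtain e where e: "e > 0" "\<And>R. R \<in> Fred \<Longrightarrow> dist R (\<Phi> (t, x)) < e \<Longrightarrow>
            fredholm_index R = fredholm_index (\<Phi> (t, x))"
          using fredholm_index_locally_constant \<Phi>[OF t x] by metis
        have "\<forall>\<^sub>F s in at t within {0..1}. dist (\<Phi> (s, x)) (\<Phi> (t, x)) < e"
          using path t e(1) by (simp add: continuous_on_def tendstoD)
        moreover have "\<forall>\<^sub>F s in at t within {0..1}. s \<in> {0..1}"
          by (simp add: eventually_at_filter)
        ultimately show "\<forall>\<^sub>F s in at t within {0..1}. fredholm_index (\<Phi> (t, x)) = fredholm_index (\<Phi> (s, x))"
          by eventually_elim (use e(2) \<Phi> x in metis)
      qed
    qed auto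
    then show ?thesis using \<Phi>[OF _ x, of 0] by simp
  qed
  show ?thesis
    unfolding family_index_def
  proof (rule restrict_ext)
    fix C assume C: "C \<in> connected_components_of X"
    \<comment> \<open>Both families are evaluated at the same chosen point of \<open>C\<close>, so
      equality at each point of the space suffices; components are nonempty, so the choice lies in
      \<open>C\<close>.\<close>
    then have "(SOME x. x \<in> C) \<in> C"
      using nonempty_connected_components_of by (metis some_in_eq)
    then show "fredholm_index (T (SOME x. x \<in> C)) = fredholm_index (S (SOME x. x \<in> C))"
      using index connected_components_of_subset[OF C] by blast
  qed
qed

end
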